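(* Let $d\ge 2$, let $K\subset\mathbb{R}^d$ be a convex body, and let $(\delta_n)_{n=1}^\infty$ be a sequence of positive numbers in $(0,\mathrm{vol}_d(K))$ such that $\delta_n\to 0$ as $n\to\infty$ and such that, for all $n\in\mathbb{N}$, the Dupin floating body $K_{[\delta_n]}$ of $K$ (exists and) coincides with the convex floating body $K_{\delta_n}$ of $K$. If $K$ floats in equilibrium in every orientation at the level $\delta_n$ for all $n\in\mathbb{N}$, then $K$ is a Euclidean ball.
   Context: A convex body $K\subset\mathbb{R}^d$ is a compact convex set with non-empty interior. The set $S^{d-1}$ is the unit sphere centered at the origin. For a compact convex set $L\subset\mathbb{R}^d$ with non-empty interior, $\mathcal{C}(L)=\frac{1}{\mathrm{vol}_d(L)}\int_L x\,dx$ denotes its center of mass. Let $\delta\in(0,\mathrm{vol}_d(K))$. For $\xi\in S^{d-1}$, the cutting hyperplane of $K$ in the direction $\xi$ at the level $\delta$ is $H(\xi)=\{p\in\mathbb{R}^d: p\cdot\xi=t(\xi)\}$, where $t(\xi)\in\mathbb{R}$ is chosen so that $\mathrm{vol}_d(K\cap H^-(\xi))=\delta$. Here $H^-(\xi)=\{p: p\cdot\xi\le t(\xi)\}$ and $H^+(\xi)=\{p: p\cdot\xi\ge t(\xi)\}$. $K$ floats in equilibrium in the direction $\xi$ at the level $\delta$ if the line through $\mathcal{C}(K)$ and $\mathcal{C}_\delta(\xi)=\mathcal{C}(K\cap H^-(\xi))$ is parallel to $\xi$. $K$ floats in equilibrium in every orientation at the level $\delta$ if this holds for every $\xi\in S^{d-1}$.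 A non-empty convex set $K_{[\delta]}$ is the Dupin floating body of $K$ if each supporting hyperplane of $K_{[\delta]}$ cuts off a set of volume $\delta$ from $K$; that is, for every $\xi\in S^{d-1}$, with $s=\inf_{p\in K_{[\delta]}}p\cdot\xi$, one has $\mathrm{vol}_d(K\cap\{p: p\cdot\xi\le s\})=\delta$. Such a set need not exist for every $K$ and $\delta$. The convex floating body of $K$ is $K_\delta=\bigcap_{\xi\in S^{d-1}}H^+(\xi)$. *)

theory Defs
  imports "HOL-Analysis.Analysis"
begin

definition convex_body :: "'a::euclidean_space set \<Rightarrow> bool" where
  "convex_body K \<longleftrightarrow> compact K \<and> convex K \<and> interior K \<noteq> {}"

definition center_of_mass :: "'a::euclidean_space set \<Rightarrow> 'a" where
  "center_of_mass L = (1 / measure lebesgue L) *\<^sub>R integral L (\<lambda>x. x)"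

(* For a convex body K, 0 < \<delta> < vol K and a unit vector \<xi>, the volume on the left
   is continuous in t and strictly increasing wherever it lies strictly between
   0 and vol K, so the level is uniquely determined. *)
definition cutting_level :: "'a::euclidean_space set \<Rightarrow> real \<Rightarrow> 'a \<Rightarrow> real" where
  "cutting_level K \<delta> \<xi> = (THE t. measure lebesgue (K \<inter> {p. p \<bullet> \<xi> \<le> t}) = \<delta>)"

definition lower_halfspace :: "'a::euclidean_space set \<Rightarrow> real \<Rightarrow> 'a \<Rightarrow> 'a set" where
  "lower_halfspace K \<delta> \<xi> = {p. p \<bullet> \<xi> \<le> cutting_level K \<delta> \<xi>}"

definition upper_halfspace :: "'a::euclidean_space set \<Rightarrow> real \<Rightarrow> 'a \<Rightarrow> 'a set" where
  "upper_halfspace K \<delta> \<xi> = {p. p \<bullet> \<xi> \<ge> cutting_level K \<delta> \<xi>}"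

(* The affine hull is the line through the two centers of mass. The centers are
   distinct whenever K is a convex body and 0 < \<delta> < vol K; were they equal, the
   condition would be false. *)
definition floats_in_equilibrium :: "'a::euclidean_space set \<Rightarrow> real \<Rightarrow> 'a \<Rightarrow> bool" where
  "floats_in_equilibrium K \<delta> \<xi> \<longleftrightarrow>
     affine_parallel
       (affine hull {center_of_mass K, center_of_mass (K \<inter> lower_halfspace K \<delta> \<xi>)})
       (span {\<xi>})"

definition floats_in_every_orientation :: "'a::euclidean_space set \<Rightarrow> real \<Rightarrow> bool" where
  "floats_in_every_orientation K \<delta> \<longleftrightarrow> (\<forall>\<xi>\<in>sphere 0 1. floats_in_equilibrium K \<delta> \<xi>)"

(* The infimum is meant in the extended reals: a set unbounded in direction -\<xi> has
   infimum -\<infinity> and cuts off nothing. As Inf on the reals is unspecified for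
   such sets, boundedness from below is required explicitly. *)
definition is_dupin_floating_body ::
    "'a::euclidean_space set \<Rightarrow> real \<Rightarrow> 'a set \<Rightarrow> bool" where
  "is_dupin_floating_body K \<delta> D \<longleftrightarrow>
     D \<noteq> {} \<and> convex D \<and>
     (\<forall>\<xi>\<in>sphere 0 1.
        bdd_below ((\<lambda>p. p \<bullet> \<xi>) ` D) \<and>
        measure lebesgue (K \<inter> {p. p \<bullet> \<xi> \<le> (INF p\<in>D. p \<bullet> \<xi>)}) = \<delta>)"

definition convex_floating_body :: "'a::euclidean_space set \<Rightarrow> real \<Rightarrow> 'a set" where
  "convex_floating_body K \<delta> = (\<Inter>\<xi>\<in>sphere 0 1. upper_halfspace K \<delta> \<xi>)"

end

theory Submission
  imports Defs
begin

text \<open>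
  Write \<open>C\<close> for the center of mass of \<open>K\<close> and \<open>m \<xi>\<close> for the minimum of \<open>p \<bullet> \<xi>\<close> over \<open>p \<in> K\<close>.
  The center of mass of a cap lies in the cap, and \<open>\<delta> \<rightarrow> 0\<close> forces the cutting levels to \<open>m \<xi>\<close>.
  Since the centers of the caps lie on the line through \<open>C\<close> in direction \<open>\<xi>\<close>, they converge to
  \<open>C - g \<xi> *\<^sub>R \<xi>\<close> with \<open>g \<xi> = C \<bullet> \<xi> - m \<xi>\<close>, and this point belongs to \<open>K\<close>. Testing it against
  another direction \<open>\<eta>\<close> gives \<open>g \<eta> \<ge> g \<xi> * (\<xi> \<bullet> \<eta>)\<close>, so \<open>g\<close> oscillates at most quadratically along
  great circles and is therefore constant on the unit sphere.
\<close>

section \<open>Slab volumes and uniqueness of the cutting level\<close>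

text \<open>By convexity some point of \<open>K\<close> lies in the open slab, and the interior is
  dense in \<open>K\<close>, so the slab contains a nonempty open piece of \<open>K\<close>.\<close>

lemma measure_slab_pos:
  fixes K :: "'a::euclidean_space set"
  assumes K: "convex_body K" and x: "x \<in> K" "x \<bullet> \<xi> < b" and y: "y \<in> K" "a < y \<bullet> \<xi>" and "a < b"
  shows "0 < measure lebesgue (K \<inter> {p. a < p \<bullet> \<xi> \<and> p \<bullet> \<xi> < b})"
proof -
  have cK: "compact K" "convex K" "interior K \<noteq> {}"
    using K by (auto simp: convex_body_def)
  let ?U = "{p. a < p \<bullet> \<xi> \<and> p \<bullet> \<xi> < b}"
  have oU: "open ?U"
    by (intro open_Collect_conj open_Collect_less continuous_intros)
  have "\<exists>z\<in>K. z \<in> ?U"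
  proof (cases "a < x \<bullet> \<xi> \<or> y \<bullet> \<xi> < b")
    case True
    then show ?thesis using x y by auto
  next
    case False
    \<comment> \<open>Here \<open>x\<close> and \<open>y\<close> lie on opposite sides of the slab,
      so connectedness of \<open>K\<close> yields a point at the middle height.\<close>
    have "connected ((\<lambda>p. p \<bullet> \<xi>) ` K)"
      by (intro connected_continuous_image continuous_intros convex_connected cK)
    moreover have "x \<bullet> \<xi> \<le> (a + b) / 2" "(a + b) / 2 \<le> y \<bullet> \<xi>"
      using False \<open>a < b\<close> by auto
    ultimately have "(a + b) / 2 \<in> (\<lambda>p. p \<bullet> \<xi>) ` K"
      using x y by (meson connectedD_interval imageI)
    then obtain z where "z \<in> K" "z \<bullet> \<xi> = (a + b) / 2" by force
    then show ?thesis using \<open>a < b\<close> by (intro bexI[of _ z]) auto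
  qed
  then obtain z where z: "z \<in> K" "z \<in> ?U" by blast
  have "z \<in> closure (interior K)"
    using z cK convex_closure_interior closure_subset by blast
  then have ne: "interior K \<inter> ?U \<noteq> {}"
    using oU z(2) open_Int_closure_eq_empty by blast
  have op: "open (interior K \<inter> ?U)"
    using oU by blast
  have bd: "bounded (K \<inter> ?U)"
    using cK compact_imp_bounded bounded_Int by blast
  have lm: "interior K \<inter> ?U \<in> lmeasurable" "K \<inter> ?U \<in> lmeasurable"
  proof -
    show "interior K \<inter> ?U \<in> lmeasurable"
      by (intro lmeasurable_open op bounded_subset[OF bd]) (use interior_subset in blast)
    have "K \<in> sets lebesgue" "?U \<in> sets lebesgue"
      using cK(1) oU lmeasurable_compact by (auto intro: fmeasurableD)
    then show "K \<inter> ?U \<in> lmeasurable"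
      by (intro bounded_set_imp_lmeasurable bd sets.Int)
  qed
  have "\<not> negligible (interior K \<inter> ?U)"
    using op ne open_not_negligible by blast
  then have "0 < measure lebesgue (interior K \<inter> ?U)"
    using lm(1) negligible_iff_measure zero_less_measure_iff by blast
  also have "\<dots> \<le> measure lebesgue (K \<inter> ?U)"
    using lm interior_subset by (intro measure_mono_fmeasurable) auto
  finally show ?thesis .
qed

lemma compact_convex_cap:
  fixes K :: "'a::euclidean_space set"
  assumes "convex_body K"
  shows "compact (K \<inter> {p. p \<bullet> \<xi> \<le> t})" "convex (K \<inter> {p. p \<bullet> \<xi> \<le> t})"
  using assms closed_halfspace_le[of \<xi> t] convex_halfspace_le[of \<xi> t]
  by (auto simp: convex_body_def inner_commute intro!: compact_Int_closed convex_Int)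

text \<open>Replaces the definite description by any known level of the right volume. Two such
  levels \<open>s < t\<close> would enclose a slab of volume zero; but \<open>0 < \<delta>\<close>
  puts a point of \<open>K\<close> at height at most \<open>s\<close>, and
  \<open>\<delta> < measure lebesgue K\<close> puts one above \<open>t\<close>, so that slab has
  positive volume.\<close>

lemma cutting_level_eq:
  fixes K :: "'a::euclidean_space set"
  assumes K: "convex_body K" and \<delta>: "0 < \<delta>" "\<delta> < measure lebesgue K"
    and t: "measure lebesgue (K \<inter> {p. p \<bullet> \<xi> \<le> t}) = \<delta>"
  shows "cutting_level K \<delta> \<xi> = t"
proof -
  have no: False
    if st: "s < t" "measure lebesgue (K \<inter> {p. p \<bullet> \<xi> \<le> s}) = \<delta>"
      "measure lebesgue (K \<inter> {p. p \<bullet> \<xi> \<le> t}) = \<delta>" for s t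
  proof -
    let ?S = "K \<inter> {p. p \<bullet> \<xi> \<le> s}" and ?T = "K \<inter> {p. p \<bullet> \<xi> \<le> t}"
    let ?U = "K \<inter> {p. s < p \<bullet> \<xi> \<and> p \<bullet> \<xi> < t}"
    have lm: "?S \<in> lmeasurable" "?T \<in> lmeasurable"
      using compact_convex_cap(1)[OF K] lmeasurable_compact by blast+
    have "?S \<noteq> {}" using st \<delta> by (metis measure_empty less_irrefl)
    then obtain x where x: "x \<in> K" "x \<bullet> \<xi> \<le> s" by blast
    have "?T \<noteq> K" using st \<delta> by auto
    then obtain y where y: "y \<in> K" "t < y \<bullet> \<xi>" by force
    have "0 < measure lebesgue ?U"
      using measure_slab_pos[OF K x(1) _ y(1), of \<xi> t s] x y st by auto
    also have "\<dots> \<le> measure lebesgue (?T - ?S)"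
    proof (rule measure_mono_fmeasurable)
      have "open {p. s < p \<bullet> \<xi> \<and> p \<bullet> \<xi> < t}"
        by (intro open_Collect_conj open_Collect_less continuous_intros)
      moreover have "K \<in> sets lebesgue"
        using K lmeasurable_compact by (auto simp: convex_body_def)
      ultimately show "?U \<in> sets lebesgue" by auto
    qed (use lm in auto)
    also have "\<dots> = measure lebesgue ?T - measure lebesgue ?S"
      using st(1) lm by (intro measurable_measure_Diff) (auto dest: fmeasurableD)
    finally show False using st by simp
  qed
  show ?thesis
    unfolding cutting_level_def
  proof (rule the_equality)
    fix s assume "measure lebesgue (K \<inter> {p. p \<bullet> \<xi> \<le> s}) = \<delta>"
    then show "s = t" using no[of s t] no[of t s] t by fastforce
  qed (rule t)
qed

section \<open>Centers of mass, small caps and the equilibrium condition\<close>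

text \<open>A center outside \<open>L\<close> could be strictly separated from \<open>L\<close>;
  integrating the separating inequality over \<open>L\<close> contradicts the position of the
  center.\<close>

lemma center_of_mass_in:
  fixes L :: "'a::euclidean_space set"
  assumes L: "compact L" "convex L" "0 < measure lebesgue L"
  shows "center_of_mass L \<in> L"
proof (rule ccontr)
  assume "center_of_mass L \<notin> L"
  then obtain a b where ab: "a \<bullet> center_of_mass L < b" "\<forall>x\<in>L. a \<bullet> x > b"
    using separating_hyperplane_closed_point[of L] L compact_imp_closed by blast
  have "set_integrable lborel L (\<lambda>x. x)"
    unfolding set_integrable_def by (intro borel_integrable_compact L continuous_intros)
  then have int: "(\<lambda>x. x) integrable_on L"
    by (rule set_borel_integral_eq_integral)
  have lm: "L \<in> lmeasurable" using L lmeasurable_compact by blast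
  have "b * measure lebesgue L = integral L (\<lambda>x. b)"
    using lm by (simp add: lmeasure_integral flip: integral_mult_right)
  also have "\<dots> \<le> integral L (\<lambda>x. a \<bullet> x)"
    using integrable_on_const[OF lm]
      integrable_linear[OF int bounded_linear_inner_right[of a]] ab(2)
    by (intro integral_le) (auto simp: o_def)
  also have "\<dots> = a \<bullet> integral L (\<lambda>x. x)"
    using integral_linear[OF int bounded_linear_inner_right[of a]] by (simp add: o_def)
  also have "\<dots> = (a \<bullet> center_of_mass L) * measure lebesgue L"
    using L by (simp add: center_of_mass_def)
  finally show False using ab(1) L(3) by simp
qed

text \<open>No level lies below the minimal height, since a cap of positive volume is nonempty. For
  \<open>b\<close> above the minimum, the slab between them has a fixed positive volume, and a level
  \<open>t n \<ge> b\<close> would put it inside a cap of volume \<open>\<delta> n\<close>. The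
  point \<open>y\<close> keeps \<open>K\<close> from being flat in direction
  \<open>\<xi>\<close>.\<close>

lemma cutting_levels_tendsto:
  fixes K :: "'a::euclidean_space set"
  assumes K: "convex_body K" and "\<delta> \<longlonglongrightarrow> 0"
    and \<delta>: "\<And>n. 0 < \<delta> n"
    and t: "\<And>n. measure lebesgue (K \<inter> {p. p \<bullet> \<xi> \<le> t n}) = \<delta> n"
    and x: "x \<in> K" "\<And>y. y \<in> K \<Longrightarrow> x \<bullet> \<xi> \<le> y \<bullet> \<xi>"
    and nc: "y \<in> K" "x \<bullet> \<xi> < y \<bullet> \<xi>"
  shows "t \<longlonglongrightarrow> x \<bullet> \<xi>"
proof (rule order_tendstoI)
  fix a assume "a < x \<bullet> \<xi>"
  moreover have "x \<bullet> \<xi> \<le> t n" for n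
  proof -
    have "K \<inter> {p. p \<bullet> \<xi> \<le> t n} \<noteq> {}" using t[of n] \<delta>[of n] by (metis measure_empty less_irrefl)
    then show ?thesis using x(2) by force
  qed
  ultimately show "\<forall>\<^sub>F n in sequentially. a < t n"
    by (intro always_eventually) (meson less_le_trans)
next
  fix b assume b: "x \<bullet> \<xi> < b"
  let ?a = "x \<bullet> \<xi>"
  let ?U = "K \<inter> {p. ?a < p \<bullet> \<xi> \<and> p \<bullet> \<xi> < b}"
  have pos: "0 < measure lebesgue ?U"
    using measure_slab_pos[OF K x(1) b nc] b by auto
  then have "\<forall>\<^sub>F n in sequentially. \<delta> n < measure lebesgue ?U"
    using \<open>\<delta> \<longlonglongrightarrow> 0\<close> order_tendstoD(2) by blast
  then show "\<forall>\<^sub>F n in sequentially. t n < b"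
  proof eventually_elim
    case (elim n)
    show ?case
    proof (rule ccontr)
      assume "\<not> t n < b"
      then have "measure lebesgue ?U \<le> measure lebesgue (K \<inter> {p. p \<bullet> \<xi> \<le> t n})"
      proof (intro measure_mono_fmeasurable)
        have "open {p. ?a < p \<bullet> \<xi> \<and> p \<bullet> \<xi> < b}"
          by (intro open_Collect_conj open_Collect_less continuous_intros)
        moreover have "K \<in> sets lebesgue"
          using K lmeasurable_compact by (auto simp: convex_body_def)
        ultimately show "?U \<in> sets lebesgue" by auto
        show "K \<inter> {p. p \<bullet> \<xi> \<le> t n} \<in> lmeasurable"
          using compact_convex_cap(1)[OF K] lmeasurable_compact by blast
      qed auto
      then show False using elim t by simp
    qed
  qed
qed

text \<open>Turns equilibrium into an equation in which \<open>b\<close> depends only on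
  \<open>a\<close> and the height of \<open>b\<close>. The difference \<open>b - a\<close> is a
  multiple of \<open>\<xi>\<close>, and pairing with the unit vector \<open>\<xi>\<close> reads off
  the factor.\<close>

lemma affine_parallel_span_singleton:
  fixes \<xi> :: "'a::euclidean_space"
  assumes "affine_parallel (affine hull {a, b}) (span {\<xi>})" "norm \<xi> = 1"
  shows "b = a + (b \<bullet> \<xi> - a \<bullet> \<xi>) *\<^sub>R \<xi>"
proof -
  obtain v where v: "span {\<xi>} = (\<lambda>x. v + x) ` (affine hull {a, b})"
    using assms(1) unfolding affine_parallel_def by blast
  have "v + a \<in> span {\<xi>}" "v + b \<in> span {\<xi>}"
    unfolding v by (auto intro!: imageI hull_inc)
  then have "(v + b) - (v + a) \<in> span {\<xi>}" using span_diff by blast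
  then obtain k where k: "b - a = k *\<^sub>R \<xi>" by (auto simp: span_singleton)
  then have "(b - a) \<bullet> \<xi> = k"
    using assms(2) by (simp add: norm_eq_1)
  then show ?thesis using k by (simp add: inner_diff_left algebra_simps)
qed

section \<open>Constancy along great circles\<close>

text \<open>Exchanging \<open>s\<close> and \<open>t\<close> bounds the absolute difference, so the
  difference quotients are at most \<open>M * \<bar>y - x\<bar>\<close> and the derivative vanishes
  everywhere.\<close>

lemma constant_if_quadratic_modulus:
  fixes f :: "real \<Rightarrow> real"
  assumes "\<And>s t. f s - f t \<le> M * (s - t)\<^sup>2"
  shows "f s = f t"
proof (rule DERIV_isconst_all[of f], intro allI)
  fix x
  have ab: "\<bar>f y - f x\<bar> \<le> M * (y - x)\<^sup>2" for y
    using assms[of y x] assms[of x y] by (simp add: power2_commute abs_le_iff)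
  have "((\<lambda>y. (f y - f x) / (y - x)) \<longlongrightarrow> 0) (at x)"
  proof (rule Lim_null_comparison)
    show "\<forall>\<^sub>F y in at x. norm ((f y - f x) / (y - x)) \<le> M * \<bar>y - x\<bar>"
    proof (intro always_eventually allI)
      fix y :: real
      have "\<bar>f y - f x\<bar> \<le> M * \<bar>y - x\<bar> * \<bar>y - x\<bar>"
        using ab[of y] by (simp add: power2_eq_square mult.assoc)
      \<comment> \<open>The bound also covers \<open>y = x\<close>, where division by zero yields
        \<open>0\<close>.\<close>
      then show "norm ((f y - f x) / (y - x)) \<le> M * \<bar>y - x\<bar>"
        by (cases "y = x") (simp_all add: pos_divide_le_eq)
    qed
    have "((\<lambda>y. M * \<bar>y - x\<bar>) \<longlongrightarrow> M * \<bar>x - x\<bar>) (at x)"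
      by (intro tendsto_intros)
    then show "((\<lambda>y. M * \<bar>y - x\<bar>) \<longlongrightarrow> 0) (at x)" by simp
  qed
  then show "(f has_real_derivative 0) (at x)"
    by (simp add: has_field_derivative_iff)
qed

text \<open>The vector \<open>e\<close> is the normalized component of \<open>\<xi>\<close>
  orthogonal to \<open>\<eta>\<close>.\<close>

lemma great_circle_through:
  fixes \<xi> \<eta> :: "'a::euclidean_space"
  assumes "2 \<le> DIM('a)" "norm \<xi> = 1" "norm \<eta> = 1"
  obtains e t where "norm e = 1" "\<eta> \<bullet> e = 0" "\<xi> = cos t *\<^sub>R \<eta> + sin t *\<^sub>R e"
proof -
  let ?v = "\<xi> - (\<xi> \<bullet> \<eta>) *\<^sub>R \<eta>"
  have ee: "\<eta> \<bullet> \<eta> = 1" "\<xi> \<bullet> \<xi> = 1" using assms by (auto simp: norm_eq_1)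
  have "\<exists>e s. norm e = 1 \<and> \<eta> \<bullet> e = 0 \<and> ?v = s *\<^sub>R e"
  proof (cases "?v = 0")
    case True
    \<comment> \<open>Now \<open>\<xi>\<close> is a multiple of \<open>\<eta>\<close>, and any unit
      vector orthogonal to \<open>\<eta>\<close> serves as \<open>e\<close>; it exists because the
      dimension is at least two.\<close>
    obtain y where y: "y \<noteq> 0" "\<eta> \<bullet> y = 0"
      using assms(1) orthogonal_to_vector_exists[of \<eta>] unfolding orthogonal_def by blast
    then show ?thesis using True
      by (intro exI[of _ "y /\<^sub>R norm y"] exI[of _ 0]) auto
  next
    case False
    then show ?thesis using ee
      by (intro exI[of _ "?v /\<^sub>R norm ?v"] exI[of _ "norm ?v"])
        (auto simp: inner_diff_right inner_commute)
  qed
  then obtain e s where e: "norm e = 1" "\<eta> \<bullet> e = 0" "?v = s *\<^sub>R e" by blast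
  then have \<xi>: "\<xi> = (\<xi> \<bullet> \<eta>) *\<^sub>R \<eta> + s *\<^sub>R e" by (metis add_diff_cancel_left' diff_add_cancel add.commute)
  \<comment> \<open>The squares of the two coefficients sum to one, which makes them the cosine and
    sine of some angle.\<close>
  have "1 = ((\<xi> \<bullet> \<eta>) *\<^sub>R \<eta> + s *\<^sub>R e) \<bullet> ((\<xi> \<bullet> \<eta>) *\<^sub>R \<eta> + s *\<^sub>R e)"
    using ee \<xi> by simp
  also have "\<dots> = (\<xi> \<bullet> \<eta>)\<^sup>2 + s\<^sup>2"
    using ee e by (simp add: inner_add_left inner_add_right inner_commute norm_eq_1 power2_eq_square)
  finally obtain t where "\<xi> \<bullet> \<eta> = cos t" "s = sin t"
    using sincos_total_2pi by metis
  then show ?thesis using that e \<xi> by metis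
qed

text \<open>On a great circle the inner product of two points is the cosine of the parameter
  difference. The hypothesis on \<open>g\<close> thus bounds increments by
  \<open>M * (1 - cos (s - t))\<close>, which is quadratic in \<open>s - t\<close>.\<close>

lemma constant_on_sphere:
  fixes g :: "'a::euclidean_space \<Rightarrow> real"
  assumes dim: "2 \<le> DIM('a)"
    and g: "\<And>\<xi> \<eta>. norm \<xi> = 1 \<Longrightarrow> norm \<eta> = 1 \<Longrightarrow> g \<xi> * (\<xi> \<bullet> \<eta>) \<le> g \<eta>"
    and M: "\<And>\<xi>. norm \<xi> = 1 \<Longrightarrow> g \<xi> \<le> M"
    and "norm \<xi> = 1" "norm \<eta> = 1"
  shows "g \<xi> = g \<eta>"
proof -
  obtain e t where e: "norm e = 1" "\<eta> \<bullet> e = 0" and \<xi>: "\<xi> = cos t *\<^sub>R \<eta> + sin t *\<^sub>R e"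
    using great_circle_through[OF dim assms(4,5)] by blast
  let ?\<gamma> = "\<lambda>t. cos t *\<^sub>R \<eta> + sin t *\<^sub>R e"
  have inner: "?\<gamma> s \<bullet> ?\<gamma> t = cos (s - t)" for s t
    using e assms(5)
    by (simp add: inner_add_left inner_add_right inner_commute norm_eq_1 cos_diff)
  have unit: "norm (?\<gamma> s) = 1" for s
    using inner[of s s] by (simp add: norm_eq_1)
  have cos: "1 - cos x \<le> x\<^sup>2 / 2" for x :: real
  proof -
    have "(sin (x / 2))\<^sup>2 \<le> (x / 2)\<^sup>2"
      using abs_sin_x_le_abs_x abs_le_square_iff by blast
    moreover have "cos x = 1 - 2 * (sin (x / 2))\<^sup>2"
      using cos_double_sin[of "x / 2"] by simp
    ultimately show ?thesis by (simp add: power_divide)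
  qed
  have "g (?\<gamma> s) - g (?\<gamma> t) \<le> M / 2 * (s - t)\<^sup>2" for s t
  proof -
    \<comment> \<open>For orthogonal directions the hypothesis on \<open>g\<close> reads
      \<open>0 \<le> g \<eta>\<close>.\<close>
    have "0 \<le> M"
      using g[of "?\<gamma> 0" "?\<gamma> (pi / 2)"] M[of "?\<gamma> (pi / 2)"] e assms(5) by simp
    have "g (?\<gamma> s) - g (?\<gamma> t) \<le> g (?\<gamma> s) * (1 - cos (s - t))"
      using g[OF unit unit, of s t] unfolding inner by (simp add: right_diff_distrib)
    also have "\<dots> \<le> M * (1 - cos (s - t))"
      using M[OF unit] by (intro mult_right_mono) auto
    also have "\<dots> \<le> M * ((s - t)\<^sup>2 / 2)"
      by (intro mult_left_mono cos \<open>0 \<le> M\<close>)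
    finally show ?thesis by simp
  qed
  then have "g (?\<gamma> t) = g (?\<gamma> 0)"
    by (rule constant_if_quadratic_modulus[where f = "\<lambda>t. g (?\<gamma> t)"])
  then show ?thesis using \<xi> by simp
qed

section \<open>Recognizing a ball from its supporting hyperplanes\<close>

text \<open>Here \<open>g \<xi>\<close> is the distance from \<open>C\<close> to the supporting
  hyperplane with inner normal \<open>\<xi>\<close>, which \<open>K\<close> touches at the foot of
  the perpendicular from \<open>C\<close>. Once \<open>g\<close> has the constant value
  \<open>r\<close>, the supporting half-spaces confine \<open>K\<close> to the ball, and the
  segments from \<open>C\<close> to the feet fill it.\<close>

lemma eq_cball_if_touching_points_radial:
  fixes K :: "'a::euclidean_space set"
  assumes dim: "2 \<le> DIM('a)" and K: "convex_body K" and C: "C \<in> K"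
    and q: "\<And>\<xi>. norm \<xi> = 1 \<Longrightarrow> C - g \<xi> *\<^sub>R \<xi> \<in> K"
    and supp: "\<And>\<xi> p. norm \<xi> = 1 \<Longrightarrow> p \<in> K \<Longrightarrow> C \<bullet> \<xi> - g \<xi> \<le> p \<bullet> \<xi>"
  shows "\<exists>r>0. K = cball C r"
proof -
  obtain M where M: "\<And>p. p \<in> K \<Longrightarrow> dist C p \<le> M"
    using K bounded_any_center[of K C] compact_imp_bounded by (auto simp: convex_body_def)
  have gM: "g \<xi> \<le> M" if "norm \<xi> = 1" for \<xi>
    using M[OF q[OF that]] that by (simp add: dist_norm)
  have g: "g \<xi> * (\<xi> \<bullet> \<eta>) \<le> g \<eta>" if "norm \<xi> = 1" "norm \<eta> = 1" for \<xi> \<eta>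
    using supp[OF that(2) q[OF that(1)]] by (simp add: inner_diff_left)
  obtain e :: 'a where e: "norm e = 1"
    using vector_choose_size[of 1] by auto
  define r where "r = g e"
  have gr: "g \<xi> = r" if "norm \<xi> = 1" for \<xi>
    unfolding r_def by (rule constant_on_sphere[OF dim g gM that e])
  have r0: "0 \<le> r"
    using supp[OF e C] by (simp add: r_def)
  have sub: "K \<subseteq> cball C r"
  proof
    fix p assume p: "p \<in> K"
    show "p \<in> cball C r"
    proof (cases "p = C")
      case False
      \<comment> \<open>With \<open>\<xi>\<close> pointing from \<open>p\<close> to
        \<open>C\<close>, the support inequality bounds exactly the distance from \<open>C\<close>
        to \<open>p\<close>.\<close>
      define \<xi> where "\<xi> = (C - p) /\<^sub>R norm (C - p)"
      have "norm \<xi> = 1" using False by (simp add: \<xi>_def)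
      then have "(C - p) \<bullet> \<xi> \<le> r"
        using supp[OF _ p] gr by (auto simp: inner_diff_left algebra_simps)
      moreover have "(C - p) \<bullet> \<xi> = norm (C - p)"
        using False by (simp add: \<xi>_def dot_square_norm power2_eq_square)
      ultimately show ?thesis by (simp add: dist_norm)
    qed (use r0 in simp)
  qed
  \<comment> \<open>Radius zero would reduce \<open>K\<close> to a single point, which has empty
    interior.\<close>
  have "r > 0"
  proof (rule ccontr)
    assume "\<not> r > 0"
    then have "K \<subseteq> {C}" using sub r0 by (auto simp: antisym)
    then have "interior K \<subseteq> interior {C}" by (rule interior_mono)
    then show False using K by (simp add: convex_body_def)
  qed
  moreover have "cball C r \<subseteq> K"
  proof
    fix p assume p: "p \<in> cball C r"
    show "p \<in> K"
    proof (cases "p = C")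
      case False
      define \<xi> where "\<xi> = (C - p) /\<^sub>R norm (C - p)"
      \<comment> \<open>The point \<open>p\<close> divides the segment from \<open>C\<close> to the
        foot \<open>C - r *\<^sub>R \<xi>\<close> in the proportion \<open>u\<close>.\<close>
      define u where "u = norm (C - p) / r"
      have \<xi>: "norm \<xi> = 1" using False by (simp add: \<xi>_def)
      have u: "0 \<le> u" "u \<le> 1" using p \<open>r > 0\<close> by (auto simp: u_def dist_norm)
      have "(1 - u) *\<^sub>R C + u *\<^sub>R (C - r *\<^sub>R \<xi>) \<in> K"
        using K q[OF \<xi>] gr[OF \<xi>] C u by (intro convexD) (auto simp: convex_body_def)
      moreover have "(u * r) *\<^sub>R \<xi> = C - p"
        using False \<open>r > 0\<close> by (simp add: u_def \<xi>_def)
      then have "(1 - u) *\<^sub>R C + u *\<^sub>R (C - r *\<^sub>R \<xi>) = p"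
        by (simp add: algebra_simps)
      ultimately show ?thesis by simp
    qed (use C in simp)
  qed
  ultimately show ?thesis using sub by blast
qed

section \<open>Touching points from equilibrium, and the conclusion\<close>

text \<open>The minimizer \<open>x\<close> enters only through its height. The heights of the cap
  centers are squeezed between it and the levels; equilibrium recovers the centers from their
  heights, so they converge, and the limit stays in the closed set \<open>K\<close>.\<close>

lemma touching_point_radial:
  fixes K :: "'a::euclidean_space set"
  assumes K: "convex_body K"
    and \<delta>: "\<And>n. 0 < \<delta> n" "\<And>n. \<delta> n < measure lebesgue K" "\<delta> \<longlonglongrightarrow> 0"
    and t: "\<And>n. measure lebesgue (K \<inter> {p. p \<bullet> \<xi> \<le> t n}) = \<delta> n"
    and eq: "\<And>n. floats_in_equilibrium K (\<delta> n) \<xi>" and \<xi>: "norm \<xi> = 1"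
    and x: "x \<in> K" "\<And>y. y \<in> K \<Longrightarrow> x \<bullet> \<xi> \<le> y \<bullet> \<xi>"
  shows "center_of_mass K - (center_of_mass K \<bullet> \<xi> - x \<bullet> \<xi>) *\<^sub>R \<xi> \<in> K"
proof -
  let ?C = "center_of_mass K"
  let ?L = "\<lambda>n. K \<inter> {p. p \<bullet> \<xi> \<le> t n}"
  define c where "c = (\<lambda>n. center_of_mass (?L n))"
  have lev: "cutting_level K (\<delta> n) \<xi> = t n" for n
    using cutting_level_eq[OF K \<delta>(1,2) t] .
  have cL: "c n \<in> ?L n" for n
    unfolding c_def using compact_convex_cap[OF K] t \<delta>(1) by (intro center_of_mass_in) auto
  \<comment> \<open>If all of \<open>K\<close> lay at the minimal height, the cap at level
    \<open>t 0\<close> would be all of \<open>K\<close>, although its volume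
    \<open>\<delta> 0\<close> is smaller.\<close>
  have "\<exists>y\<in>K. x \<bullet> \<xi> < y \<bullet> \<xi>"
  proof (rule ccontr)
    assume "\<not> (\<exists>y\<in>K. x \<bullet> \<xi> < y \<bullet> \<xi>)"
    moreover have "x \<bullet> \<xi> \<le> t 0" using cL[of 0] x(2) by force
    ultimately have "?L 0 = K" by force
    then show False using t[of 0] \<delta>(2)[of 0] by simp
  qed
  then obtain y where "y \<in> K" "x \<bullet> \<xi> < y \<bullet> \<xi>" by blast
  then have lim: "t \<longlonglongrightarrow> x \<bullet> \<xi>"
    using cutting_levels_tendsto[OF K \<delta>(3,1) t x] by blast
  have "(\<lambda>n. c n \<bullet> \<xi>) \<longlonglongrightarrow> x \<bullet> \<xi>"
    by (rule tendsto_sandwich[OF _ _ tendsto_const lim]) (use cL x(2) in auto)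
  then have lim_c: "(\<lambda>n. ?C + (c n \<bullet> \<xi> - ?C \<bullet> \<xi>) *\<^sub>R \<xi>) \<longlonglongrightarrow> ?C + (x \<bullet> \<xi> - ?C \<bullet> \<xi>) *\<^sub>R \<xi>"
    by (intro tendsto_add tendsto_scaleR tendsto_diff tendsto_const)
  have c: "c n = ?C + (c n \<bullet> \<xi> - ?C \<bullet> \<xi>) *\<^sub>R \<xi>" for n
    using eq[of n] \<xi> unfolding floats_in_equilibrium_def lower_halfspace_def lev c_def
    by (rule affine_parallel_span_singleton)
  have "c \<longlonglongrightarrow> ?C + (x \<bullet> \<xi> - ?C \<bullet> \<xi>) *\<^sub>R \<xi>"
    by (rule Lim_transform_eventually[OF lim_c]) (intro always_eventually allI c[symmetric])
  moreover have "closed K" using K compact_imp_closed by (auto simp: convex_body_def)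
  ultimately have "?C + (x \<bullet> \<xi> - ?C \<bullet> \<xi>) *\<^sub>R \<xi> \<in> K"
    using cL closed_sequentially by blast
  then show ?thesis by (simp add: algebra_simps)
qed

theorem corollary2:
  fixes K :: "(real ^ 'n) set" and \<delta> :: "nat \<Rightarrow> real"
  assumes "CARD('n) \<ge> 2"
    and "convex_body K"
    and "\<And>n. 0 < \<delta> n \<and> \<delta> n < measure lebesgue K"
    and "\<delta> \<longlonglongrightarrow> 0"
    and "\<And>n. is_dupin_floating_body K (\<delta> n) (convex_floating_body K (\<delta> n))"
    and "\<And>n. floats_in_every_orientation K (\<delta> n)"
  shows "\<exists>c r. r > 0 \<and> K = cball c r"
proof -
  have K: "compact K" "convex K" "K \<noteq> {}"
    using assms(2) by (auto simp: convex_body_def)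
  have "\<exists>x\<in>K. \<forall>y\<in>K. x \<bullet> \<xi> \<le> y \<bullet> \<xi>" for \<xi>
    using K by (intro continuous_attains_inf continuous_intros)
  then obtain x where x: "\<And>\<xi>. x \<xi> \<in> K" "\<And>\<xi> y. y \<in> K \<Longrightarrow> x \<xi> \<bullet> \<xi> \<le> y \<bullet> \<xi>"
    by metis
  let ?C = "center_of_mass K"
  define g where "g \<xi> = ?C \<bullet> \<xi> - x \<xi> \<bullet> \<xi>" for \<xi>
  have "?C - g \<xi> *\<^sub>R \<xi> \<in> K" if \<xi>: "norm \<xi> = 1" for \<xi>
    unfolding g_def
  proof (rule touching_point_radial[OF assms(2) _ _ assms(4)])
    \<comment> \<open>The Dupin property supplies the levels explicitly, as the heights of the
      supporting hyperplanes of the floating body.\<close>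
    show "measure lebesgue (K \<inter> {p. p \<bullet> \<xi> \<le> (INF p\<in>convex_floating_body K (\<delta> n). p \<bullet> \<xi>)}) = \<delta> n"
      for n
      using assms(5)[of n] \<xi> by (simp add: is_dupin_floating_body_def)
    show "floats_in_equilibrium K (\<delta> n) \<xi>" for n
      using assms(6)[of n] \<xi> by (simp add: floats_in_every_orientation_def)
  qed (use assms(3) x \<xi> in auto)
  moreover have "?C \<in> K"
    using assms(3)[of 0] K by (intro center_of_mass_in) auto
  moreover have "?C \<bullet> \<xi> - g \<xi> \<le> p \<bullet> \<xi>" if "p \<in> K" for \<xi> p
    using x(2)[OF that] by (simp add: g_def)
  ultimately show ?thesis
    using eq_cball_if_touching_points_radial[of K ?C g] assms(1,2) by auto
qed

end
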